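(* Let $\mathcal{X}\in\mathbb{R}^{I_1\times\cdots\times I_N}$ be a real $N$th-order tensor, let $n\in\{1,\ldots,N\}$, let $\mathfrak{U}_n\subset\mathbb{R}^{I_n}$ be a linear subspace, and let $\mathbf{P}_n\in\mathbb{R}^{I_n\times I_n}$ be the orthogonal projection matrix onto $\mathfrak{U}_n$. Put $\mathcal{X}_+:=\mathcal{X}\times_n\mathbf{P}_n$ and $\mathcal{X}_-:=\mathcal{X}\times_n(\mathbf{I}-\mathbf{P}_n)$. Then $$\|\mathcal{X}\|_F^2=\|\mathcal{X}_+\|_F^2+\|\mathcal{X}_-\|_F^2.$$
   Context: For a tensor $\mathcal{X}\in\mathbb{R}^{I_1\times\cdots\times I_N}$, a mode-$n$ fiber is the vector $\mathcal{X}(i_1,\ldots,i_{n-1},:,i_{n+1},\ldots,i_N)\in\mathbb{R}^{I_n}$ obtained by fixing all indices except the $n$th. For a matrix $\mathbf{A}\in\mathbb{R}^{J\times I_n}$, the mode-$n$ product $\mathcal{Y}=\mathcal{X}\times_n\mathbf{A}$ is the tensor obtained by left-multiplying each mode-$n$ fiber by $\mathbf{A}$: $\mathcal{Y}(i_1,\ldots,i_{n-1},:,i_{n+1},\ldots,i_N)=\mathbf{A}\,\mathcal{X}(i_1,\ldots,i_{n-1},:,i_{n+1},\ldots,i_N)$. If $\mathfrak{U}_n$ has dimension $r$ and $\mathbf{U}\in\mathbb{R}^{I_n\times r}$ has columns forming an orthonormal basis of $\mathfrak{U}_n$, the orthogonal projection matrix onto $\mathfrak{U}_n$ is $\mathbf{P}_n=\mathbf{U}\mathbf{U}^\top$.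 $\mathbf{I}$ is the $I_n\times I_n$ identity matrix. The inner product of tensors of the same size is $\langle\mathcal{X},\mathcal{Y}\rangle=\sum_{i_1,\ldots,i_N}\mathcal{X}(i_1,\ldots,i_N)\mathcal{Y}(i_1,\ldots,i_N)$, and the Frobenius norm is $\|\mathcal{X}\|_F=\sqrt{\langle\mathcal{X},\mathcal{X}\rangle}$. The pair $(\mathcal{X}_+,\mathcal{X}_-)$ is called the Tensor Orthogonal Subspace Split (TOSS) of $\mathcal{X}$ along mode $n$ with respect to $\mathfrak{U}_n$. *)

theory Defs
  imports
    "HOL-Library.FuncSet"
    "Jordan_Normal_Form.VS_Connect"
begin

text \<open>
  A real tensor of size \<open>Is = [I\<^sub>1, \<dots>, I\<^sub>N]\<close> is an extensional function on the multi-indices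
  bounded by \<open>Is\<close>.  As for the vectors and matrices of the library, counting starts at 0, both
  for the entries and for the modes: mode \<open>n\<close> in the usual numbering is mode \<open>n - 1\<close> here.
\<close>

definition tensor_indices :: "nat list \<Rightarrow> nat list set" where
  "tensor_indices Is = {i. length i = length Is \<and> (\<forall>k < length Is. i ! k < Is ! k)}"

definition carrier_tensor :: "nat list \<Rightarrow> (nat list \<Rightarrow> real) set" where
  "carrier_tensor Is = tensor_indices Is \<rightarrow>\<^sub>E UNIV"

definition tensor_inner :: "nat list \<Rightarrow> (nat list \<Rightarrow> real) \<Rightarrow> (nat list \<Rightarrow> real) \<Rightarrow> real" where
  "tensor_inner Is X Y = (\<Sum>i \<in> tensor_indices Is. X i * Y i)"

definition frobenius_norm :: "nat list \<Rightarrow> (nat list \<Rightarrow> real) \<Rightarrow> real" where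
  "frobenius_norm Is X = sqrt (tensor_inner Is X X)"

text \<open>The mode-\<open>n\<close> fiber through the multi-index \<open>i\<close>; it does not depend on \<open>i ! n\<close>.\<close>

definition fiber :: "nat list \<Rightarrow> nat \<Rightarrow> (nat list \<Rightarrow> real) \<Rightarrow> nat list \<Rightarrow> real vec" where
  "fiber Is n X i = vec (Is ! n) (\<lambda>k. X (i[n := k]))"

text \<open>
  \<open>mode_product Is n X A\<close> is meant for \<open>X \<in> carrier_tensor Is\<close>, \<open>n < length Is\<close> and
  \<open>dim_col A = Is ! n\<close>; the size of the result is \<open>Is[n := dim_row A]\<close>.
\<close>

definition mode_product ::
    "nat list \<Rightarrow> nat \<Rightarrow> (nat list \<Rightarrow> real) \<Rightarrow> real mat \<Rightarrow> (nat list \<Rightarrow> real)" where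
  "mode_product Is n X A =
     (\<lambda>i \<in> tensor_indices (Is[n := dim_row A]). (A *\<^sub>v fiber Is n X i) $ (i ! n))"

definition orthonormal_basis_mat :: "nat \<Rightarrow> real vec set \<Rightarrow> real mat \<Rightarrow> bool" where
  "orthonormal_basis_mat d S U \<longleftrightarrow>
     dim_row U = d \<and>
     vectorspace.basis class_ring ((module_vec TYPE(real) d)\<lparr>carrier := S\<rparr>) (set (cols U)) \<and>
     (\<forall>j < dim_col U. \<forall>k < dim_col U. col U j \<bullet> col U k = (if j = k then 1 else 0))"

text \<open>
  The matrix is determined by the subspace: it does not depend on the choice of the orthonormal
  basis.
\<close>

definition is_orthogonal_projection_mat :: "nat \<Rightarrow> real vec set \<Rightarrow> real mat \<Rightarrow> bool" where
  "is_orthogonal_projection_mat d S P \<longleftrightarrow>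
     (\<exists>U. orthonormal_basis_mat d S U \<and> P = U * U\<^sup>T)"

end

theory Submission
  imports Defs
begin

text \<open>
  Summing over all multi-indices amounts to summing over the mode-\<open>n\<close> fibers and then within
  each fiber. Hence the claim is Pythagoras' theorem for \<open>v = P v + (1 - P) v\<close>, applied to each
  mode-\<open>n\<close> fiber \<open>v\<close>, where \<open>P\<close> is symmetric and idempotent.
\<close>

lemma orthogonal_projection_mat_carrier:
  assumes "is_orthogonal_projection_mat d S P"
  shows "P \<in> carrier_mat d d"
  using assms by (auto simp: is_orthogonal_projection_mat_def orthonormal_basis_mat_def)

lemma orthogonal_projection_mat_symmetric:
  assumes "is_orthogonal_projection_mat d S P"
  shows "P\<^sup>T = P"
proof -
  from assms obtain U where P: "P = U * U\<^sup>T"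
    by (auto simp: is_orthogonal_projection_mat_def)
  have "U \<in> carrier_mat (dim_row U) (dim_col U)" by auto
  then show ?thesis unfolding P by (subst transpose_mult) auto
qed

text \<open>Orthonormality of the columns means \<open>U\<^sup>T * U = 1\<^sub>m ?r\<close>, so the
  two inner factors of \<open>U * U\<^sup>T * U * U\<^sup>T\<close> cancel.\<close>

lemma orthogonal_projection_mat_idempotent:
  assumes "is_orthogonal_projection_mat d S P"
  shows "P * P = P"
proof -
  from assms obtain U where P: "P = U * U\<^sup>T"
    and on: "\<And>j k. j < dim_col U \<Longrightarrow> k < dim_col U \<Longrightarrow> col U j \<bullet> col U k = (if j = k then 1 else 0)"
    by (auto simp: is_orthogonal_projection_mat_def orthonormal_basis_mat_def)
  let ?d = "dim_row U" and ?r = "dim_col U"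
  have U: "U \<in> carrier_mat ?d ?r" and UT: "U\<^sup>T \<in> carrier_mat ?r ?d" by auto
  have "U\<^sup>T * U = 1\<^sub>m ?r"
    by (rule eq_matI) (auto simp: on)
  then have "U\<^sup>T * (U * U\<^sup>T) = U\<^sup>T"
    using assoc_mult_mat[OF UT U UT] left_mult_one_mat[OF UT] by simp
  then show ?thesis
    using assoc_mult_mat[OF U UT mult_carrier_mat[OF U UT]] by (simp add: P)
qed

text \<open>Symmetry moves one factor \<open>P\<close> across the scalar product and idempotence
  absorbs it. This makes \<open>P *\<^sub>v v\<close> orthogonal to
  \<open>v - P *\<^sub>v v\<close>, so the mixed terms vanish.\<close>

lemma scalar_prod_pythagoras:
  fixes P :: "real mat"
  assumes P: "P \<in> carrier_mat d d" and sym: "P\<^sup>T = P" and idem: "P * P = P"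
    and v: "v \<in> carrier_vec d"
  shows "v \<bullet> v = (P *\<^sub>v v) \<bullet> (P *\<^sub>v v) + ((1\<^sub>m d - P) *\<^sub>v v) \<bullet> ((1\<^sub>m d - P) *\<^sub>v v)"
proof -
  have Pv: "P *\<^sub>v v \<in> carrier_vec d" using P v by simp
  have "(P *\<^sub>v v) \<bullet> (P *\<^sub>v v) = v \<bullet> (P *\<^sub>v (P *\<^sub>v v))"
    using transpose_vec_mult_scalar[OF P Pv v] by (simp add: sym)
  also have "P *\<^sub>v (P *\<^sub>v v) = P *\<^sub>v v"
    using assoc_mult_mat_vec[OF P P v] by (simp add: idem)
  finally have orth: "(P *\<^sub>v v) \<bullet> (P *\<^sub>v v) = v \<bullet> (P *\<^sub>v v)" .
  have "(1\<^sub>m d - P) *\<^sub>v v = v - P *\<^sub>v v"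
    using minus_mult_distrib_mat_vec[OF one_carrier_mat P v] v by simp
  moreover have "(v - P *\<^sub>v v) \<bullet> (v - P *\<^sub>v v)
      = v \<bullet> v - v \<bullet> (P *\<^sub>v v) - ((P *\<^sub>v v) \<bullet> v - (P *\<^sub>v v) \<bullet> (P *\<^sub>v v))"
    using v Pv by (simp add: minus_scalar_prod_distrib[of _ d] scalar_prod_minus_distrib[of _ d])
  ultimately show ?thesis
    using orth comm_scalar_prod[OF v Pv] by simp
qed

lemma tensor_indices_update:
  assumes "j \<in> tensor_indices (Is[n := 1])" "n < length Is" "k < Is ! n"
  shows "j[n := k] \<in> tensor_indices Is"
  using assms by (auto simp: tensor_indices_def nth_list_update)

text \<open>The multi-indices bounded by \<open>Is[n := 1]\<close> have entry 0 at \<open>n\<close>; they represent the fibers.\<close>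

lemma sum_tensor_indices_fibers:
  assumes n: "n < length Is"
  shows "sum g (tensor_indices Is)
    = (\<Sum>j \<in> tensor_indices (Is[n := 1]). \<Sum>k < Is ! n. g (j[n := k]))"
proof -
  let ?J = "tensor_indices (Is[n := 1])" and ?f = "\<lambda>(j :: nat list, k). j[n := k]"
  \<comment> \<open>The bound 1 at position \<open>n\<close> forces the entry 0 there, so resetting
    that entry recovers \<open>j\<close> from \<open>j[n := k]\<close>.\<close>
  have rep: "length j = length Is" "j[n := 0] = j" if "j \<in> ?J" for j
  proof -
    show len: "length j = length Is" using that by (simp add: tensor_indices_def)
    have "\<forall>k < length Is. j ! k < Is[n := 1] ! k" using that by (simp add: tensor_indices_def)
    with n have "j ! n < Is[n := 1] ! n" by blast
    then have "j ! n = 0" using n by simp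
    then show "j[n := 0] = j" using list_update_id[of j n] by simp
  qed
  have "bij_betw ?f (?J \<times> {..<Is ! n}) (tensor_indices Is)"
  \<comment> \<open>The inverse splits a multi-index into the representative of its fiber and its
    position within that fiber.\<close>
  proof (rule bij_betw_byWitness[where f' = "\<lambda>i. (i[n := 0], i ! n)"])
    show "\<forall>p \<in> ?J \<times> {..<Is ! n}. ((?f p)[n := 0], ?f p ! n) = p"
    proof
      fix p assume "p \<in> ?J \<times> {..<Is ! n}"
      then obtain j k where p: "p = (j, k)" and j: "j \<in> ?J" by blast
      show "((?f p)[n := 0], ?f p ! n) = p" using rep[OF j] n by (simp add: p)
    qed
    show "\<forall>i \<in> tensor_indices Is. ?f (i[n := 0], i ! n) = i" by simp
    show "?f ` (?J \<times> {..<Is ! n}) \<subseteq> tensor_indices Is"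
      using n by (force intro: tensor_indices_update)
    show "(\<lambda>i. (i[n := 0], i ! n)) ` tensor_indices Is \<subseteq> ?J \<times> {..<Is ! n}"
      using n by (auto simp: tensor_indices_def nth_list_update)
  qed
  from sum.reindex_bij_betw[OF this, of g] show ?thesis
    by (simp add: sum.cartesian_product case_prod_unfold)
qed

lemma frobenius_norm_squared: "(frobenius_norm Is X)\<^sup>2 = tensor_inner Is X X"
  by (simp add: frobenius_norm_def tensor_inner_def sum_nonneg)

text \<open>For a fixed representative, the inner sum over the entry at \<open>n\<close> is the
  scalar product of the fiber with itself.\<close>

lemma frobenius_norm_squared_fibers:
  assumes "n < length Is"
  shows "(frobenius_norm Is X)\<^sup>2
    = (\<Sum>j \<in> tensor_indices (Is[n := 1]). fiber Is n X j \<bullet> fiber Is n X j)"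
  unfolding frobenius_norm_squared tensor_inner_def sum_tensor_indices_fibers[OF assms, of "\<lambda>i. X i * X i"]
  by (simp add: fiber_def scalar_prod_def atLeast0LessThan)

text \<open>Serves to carry the vector identity over to tensors. A square \<open>A\<close> preserves
  the size \<open>Is\<close>, so the fibers before and after the product share their
  representatives.\<close>

lemma fiber_mode_product:
  assumes "n < length Is" "A \<in> carrier_mat (Is ! n) (Is ! n)" "j \<in> tensor_indices (Is[n := 1])"
  shows "fiber Is n (mode_product Is n X A) j = A *\<^sub>v fiber Is n X j"
proof (rule eq_vecI)
  fix k assume "k < dim_vec (A *\<^sub>v fiber Is n X j)"
  then have k: "k < Is ! n" using assms(2) by simp
  have "length j = length Is" using assms(3) by (simp add: tensor_indices_def)
  moreover have "fiber Is n X (j[n := k]) = fiber Is n X j" by (simp add: fiber_def)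
  moreover have "Is[n := dim_row A] = Is" using assms(2) by simp
  \<comment> \<open>\<open>mode_product\<close> is restricted to the valid multi-indices, so its
    value at \<open>j[n := k]\<close> can be unfolded only with this membership.\<close>
  moreover have "j[n := k] \<in> tensor_indices Is" using assms k by (simp add: tensor_indices_update)
  ultimately have "mode_product Is n X A (j[n := k]) = (A *\<^sub>v fiber Is n X j) $ k"
    using assms(1) by (simp add: mode_product_def)
  then show "fiber Is n (mode_product Is n X A) j $ k = (A *\<^sub>v fiber Is n X j) $ k"
    using k by (subst fiber_def) simp
qed (use assms in \<open>simp add: fiber_def\<close>)

theorem mainTheorem2:
  fixes Is :: "nat list" and X Xp Xm :: "nat list \<Rightarrow> real" and n :: nat
    and S :: "real vec set" and P :: "real mat"
  assumes "X \<in> carrier_tensor Is"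
    and "n < length Is"
    and "VectorSpace.subspace class_ring S (module_vec TYPE(real) (Is ! n))"
    and "is_orthogonal_projection_mat (Is ! n) S P"
    and "Xp = mode_product Is n X P"
    and "Xm = mode_product Is n X (1\<^sub>m (Is ! n) - P)"
  shows "(frobenius_norm Is X)\<^sup>2 = (frobenius_norm Is Xp)\<^sup>2 + (frobenius_norm Is Xm)\<^sup>2"
proof -
  let ?J = "tensor_indices (Is[n := 1])" and ?Q = "1\<^sub>m (Is ! n) - P"
  note n = assms(2) and proj = assms(4)
  have P: "P \<in> carrier_mat (Is ! n) (Is ! n)"
    using proj by (rule orthogonal_projection_mat_carrier)
  then have Q: "?Q \<in> carrier_mat (Is ! n) (Is ! n)" by (rule minus_carrier_mat)
  have "fiber Is n X j \<bullet> fiber Is n X j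
      = fiber Is n Xp j \<bullet> fiber Is n Xp j + fiber Is n Xm j \<bullet> fiber Is n Xm j"
    if j: "j \<in> ?J" for j
    unfolding assms(5,6) fiber_mode_product[OF n P j] fiber_mode_product[OF n Q j]
    by (rule scalar_prod_pythagoras[OF P orthogonal_projection_mat_symmetric[OF proj]
          orthogonal_projection_mat_idempotent[OF proj]]) (simp add: fiber_def)
  \<comment> \<open>All three squared norms are sums over the same set \<open>?J\<close>, so the
    identity for single fibers is summed term by term.\<close>
  then show ?thesis
    by (simp add: frobenius_norm_squared_fibers[OF n] sum.distrib)
qed

end
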